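(* Let $\mathbb{H}$ be any set of hypersequent rules (each external-context-sharing and having exactly one active component in each premiss) and $\mathbb{S}$ any set of 2-systems such that for every $\textit{Hr}\in\mathbb{H}$ the 2-system $\textit{Sys}_{\textit{Hr}}$ belongs to $\mathbb{S}$. If the sequent $\Gamma\Rightarrow\Pi$ is derivable in $\mathrm{HLJ}+\mathbb{H}$, then $\Gamma\Rightarrow\Pi$ is derivable in $\mathrm{LJ}+\mathbb{S}$.
   Context: Sequents have the form $\Gamma\Rightarrow\Pi$ with $\Gamma$ a finite multiset of propositional intuitionistic formulae and $\Pi$ containing at most one formula. $\mathrm{LJ}$ is the standard propositional sequent calculus for intuitionistic logic (axioms $\varphi\Rightarrow\varphi$, $\bot\Rightarrow\Pi$, left/right rules for $\wedge,\vee,\to$, internal weakening and contraction, cut). A hypersequent is a finite multiset of sequents (components) written with separator $\mid$. $\mathrm{HLJ}$ has the same axioms and the rules of $\mathrm{LJ}$ with an arbitrary hypersequent context $G$ added to the conclusion and to all premisses (shared), plus external weakening (from $G$ infer $G\mid\Gamma\Rightarrow\Pi$) and external contraction (from $G\mid C\mid C$ infer $G\mid C$). $\mathcal C+\mathbb R$ is calculus $\mathcal C$ extended by rules $\mathbb R$. A hypersequent rule is external-context-sharing if all premisses have the form $G\mid H_j$ and the conclusion $G\mid H$ with the same $G$; its active components are those in the $H_j$ and $H$; here each $H_j$ is a single sequent. A 2-system is a set of sequent rules $\{(r_1),\dots,(r_k),(r_B)\}$ used only as follows: the bottom rule $(r_B)$ infers $\Gamma\Rightarrow\Pi$ from $k$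 premisses all equal to $\Gamma\Rightarrow\Pi$, where the derivation of the $i$-th premiss may contain (possibly several) applications of the top rule $(r_i)$, which infers $\Sigma_0,\Gamma'\Rightarrow\Pi'$ from $\Sigma_1,\Gamma'\Rightarrow\Pi',\dots,\Sigma_n,\Gamma'\Rightarrow\Pi'$, all applications in that instance acting on the same $\Sigma_0,\dots,\Sigma_n$. Given a hypersequent rule $\textit{Hr}$ with conclusion $G\mid\Theta_1^1,\dots,\Theta_1^{n_1},\Gamma_1\Rightarrow\Pi_1\mid\dots\mid\Theta_k^1,\dots,\Theta_k^{n_k},\Gamma_k\Rightarrow\Pi_k$ and whose premisses are partitioned into sets $M_1,\dots,M_k$, with $M_i$ consisting of premisses $G\mid C_i^1,\dots,G\mid C_i^{m_i}$ ($C_i^j$ sequents), the 2-system $\textit{Sys}_{\textit{Hr}}$ has a bottom rule with $k$ premisses and top rules $(r_i)$ inferring $\Theta_i^1,\dots,\Theta_i^{n_i},\Gamma_i\Rightarrow\Pi_i$ from $C_i^1,\dots,C_i^{m_i}$, for $1\le i\le k$. *)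

theory Defs
  imports "HOL-Library.Multiset"
begin

datatype 'a form =
    Atom 'a
  | Bot
  | And "'a form" "'a form"
  | Or "'a form" "'a form"
  | Imp "'a form" "'a form"

datatype 'a sequent = Seq "'a form multiset" "'a form option"  (infix "\<turnstile>" 55)

type_synonym 'a hypersequent = "'a sequent multiset"

inductive lj_axiom :: "'a sequent \<Rightarrow> bool" where
  identity: "lj_axiom ({#A#} \<turnstile> Some A)"
| bottom: "lj_axiom ({#Bot#} \<turnstile> P)"

text \<open>Instances of the rules of LJ: the list of premisses and the conclusion.\<close>

inductive lj_rule :: "'a sequent list \<Rightarrow> 'a sequent \<Rightarrow> bool" where
  weakL: "lj_rule [\<Gamma> \<turnstile> P] (add_mset A \<Gamma> \<turnstile> P)"
| weakR: "lj_rule [\<Gamma> \<turnstile> None] (\<Gamma> \<turnstile> Some A)"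
| contrL: "lj_rule [add_mset A (add_mset A \<Gamma>) \<turnstile> P] (add_mset A \<Gamma> \<turnstile> P)"
| cut: "lj_rule [\<Gamma> \<turnstile> Some A, add_mset A \<Delta> \<turnstile> P] (\<Gamma> + \<Delta> \<turnstile> P)"
| andL1: "lj_rule [add_mset A \<Gamma> \<turnstile> P] (add_mset (And A B) \<Gamma> \<turnstile> P)"
| andL2: "lj_rule [add_mset B \<Gamma> \<turnstile> P] (add_mset (And A B) \<Gamma> \<turnstile> P)"
| andR: "lj_rule [\<Gamma> \<turnstile> Some A, \<Gamma> \<turnstile> Some B] (\<Gamma> \<turnstile> Some (And A B))"
| orL: "lj_rule [add_mset A \<Gamma> \<turnstile> P, add_mset B \<Gamma> \<turnstile> P] (add_mset (Or A B) \<Gamma> \<turnstile> P)"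
| orR1: "lj_rule [\<Gamma> \<turnstile> Some A] (\<Gamma> \<turnstile> Some (Or A B))"
| orR2: "lj_rule [\<Gamma> \<turnstile> Some B] (\<Gamma> \<turnstile> Some (Or A B))"
| impL: "lj_rule [\<Gamma> \<turnstile> Some A, add_mset B \<Gamma> \<turnstile> P] (add_mset (Imp A B) \<Gamma> \<turnstile> P)"
| impR: "lj_rule [add_mset A \<Gamma> \<turnstile> Some B] (\<Gamma> \<turnstile> Some (Imp A B))"


section \<open>Rule schemata\<close>

text \<open>
  The atoms of a schematic formula, of type \<open>nat form\<close>, are formula metavariables.
  \<open>MVar\<close> is a metavariable for multisets. The metavariables \<open>CtxL\<close> (for
  multisets) and \<open>CtxR\<close> (for right-hand sides) are kept apart from the others, since they
  are the contexts \<open>\<Gamma>\<^sub>i\<close> and \<open>\<Pi>\<^sub>i\<close>, which in a 2-system may vary between the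
  applications of a top rule, whereas all other metavariables are shared.
\<close>

datatype item = FVar "nat form" | MVar nat | CtxL nat

datatype rhs = Empty | Single "nat form" | CtxR nat

datatype sseq = SSeq "item multiset" rhs

text \<open>
  An instance is given by \<open>f\<close> (formula metavariables), \<open>m\<close> (multiset metavariables),
  \<open>g\<close> and \<open>p\<close> (left and right context metavariables).
\<close>

primrec subst :: "(nat \<Rightarrow> 'a form) \<Rightarrow> nat form \<Rightarrow> 'a form" where
  "subst f (Atom v) = f v"
| "subst f Bot = Bot"
| "subst f (And A B) = And (subst f A) (subst f B)"
| "subst f (Or A B) = Or (subst f A) (subst f B)"
| "subst f (Imp A B) = Imp (subst f A) (subst f B)"

primrec inst_item ::
  "(nat \<Rightarrow> 'a form) \<Rightarrow> (nat \<Rightarrow> 'a form multiset) \<Rightarrow> (nat \<Rightarrow> 'a form multiset) \<Rightarrow> item \<Rightarrow> 'a form multiset"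
where
  "inst_item f m g (FVar A) = {#subst f A#}"
| "inst_item f m g (MVar v) = m v"
| "inst_item f m g (CtxL c) = g c"

primrec inst_rhs :: "(nat \<Rightarrow> 'a form) \<Rightarrow> (nat \<Rightarrow> 'a form option) \<Rightarrow> rhs \<Rightarrow> 'a form option" where
  "inst_rhs f p Empty = None"
| "inst_rhs f p (Single A) = Some (subst f A)"
| "inst_rhs f p (CtxR c) = p c"

primrec inst ::
  "(nat \<Rightarrow> 'a form) \<Rightarrow> (nat \<Rightarrow> 'a form multiset) \<Rightarrow> (nat \<Rightarrow> 'a form multiset) \<Rightarrow> (nat \<Rightarrow> 'a form option)
    \<Rightarrow> sseq \<Rightarrow> 'a sequent"
where
  "inst f m g p (SSeq \<Sigma> R) = (\<Sum>\<^sub># (image_mset (inst_item f m g) \<Sigma>) \<turnstile> inst_rhs f p R)"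

datatype srule = SRule (premisses: "sseq list") (conclusion: sseq)


section \<open>Hypersequent calculi\<close>

text \<open>
  An external-context-sharing hypersequent rule with one active component per premiss, together
  with the partition of its premisses, is a list with one entry for each active component
  of the conclusion: entry \<open>i\<close> consists of
  \<open>\<Theta>\<^sub>i\<close> (the items \<open>\<Theta>\<^sub>i\<^sup>1, \<dots>\<close>) and of the active components
  \<open>C\<^sub>i\<^sup>1, \<dots>\<close> of the premisses in \<open>M\<^sub>i\<close>. The external context \<open>G\<close>, shared by all premisses
  and the conclusion, is added when the rule is applied.
\<close>

datatype hcomp = HComp (theta: "item list") (actives: "sseq list")

type_synonym hrule = "hcomp list"

definition active_concl :: "hrule \<Rightarrow> nat \<Rightarrow> sseq" where
  "active_concl Hr i = SSeq (mset (theta (Hr ! i)) + {#CtxL i#}) (CtxR i)"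

inductive HLJ :: "hrule set \<Rightarrow> 'a hypersequent \<Rightarrow> bool" for H :: "hrule set" where
  ax: "lj_axiom s \<Longrightarrow> HLJ H {#s#}"
| rule: "lj_rule Ps s \<Longrightarrow> \<forall>s' \<in> set Ps. HLJ H (add_mset s' G) \<Longrightarrow> HLJ H (add_mset s G)"
| EW: "HLJ H G \<Longrightarrow> HLJ H (add_mset s G)"
| EC: "HLJ H (add_mset s (add_mset s G)) \<Longrightarrow> HLJ H (add_mset s G)"
| hyper: "Hr \<in> H
    \<Longrightarrow> \<forall>i < length Hr. \<forall>C \<in> set (actives (Hr ! i)). HLJ H (add_mset (inst f m g p C) G)
    \<Longrightarrow> HLJ H (mset (map (\<lambda>i. inst f m g p (active_concl Hr i)) [0..<length Hr]) + G)"


section \<open>2-systems\<close>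

text \<open>
  A 2-system is given by the list of its top rules \<open>r\<^sub>1, \<dots>, r\<^sub>k\<close>, which determines the bottom
  rule. Every \<open>r\<^sub>i\<close> infers
  \<open>\<Sigma>\<^sub>0, \<Gamma>' \<Rightarrow> \<Pi>'\<close> from \<open>\<Sigma>\<^sub>1, \<Gamma>' \<Rightarrow> \<Pi>'\<close>, \<dots>, \<open>\<Sigma>\<^sub>n, \<Gamma>' \<Rightarrow> \<Pi>'\<close>, where the
  context metavariables do not occur in the \<open>\<Sigma>\<^sub>j\<close>.
\<close>

definition ctx_free :: "item multiset \<Rightarrow> bool" where
  "ctx_free \<Sigma> \<longleftrightarrow> (\<forall>c. CtxL c \<notin># \<Sigma>)"

definition top_rule :: "srule \<Rightarrow> bool" where
  "top_rule r \<longleftrightarrow> (\<exists>\<Sigma>0 \<Sigma>s c d. ctx_free \<Sigma>0 \<and> (\<forall>\<Sigma> \<in> set \<Sigma>s. ctx_free \<Sigma>) \<and>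
     r = SRule (map (\<lambda>\<Sigma>. SSeq (\<Sigma> + {#CtxL c#}) (CtxR d)) \<Sigma>s) (SSeq (\<Sigma>0 + {#CtxL c#}) (CtxR d)))"

definition two_system :: "srule list \<Rightarrow> bool" where
  "two_system Sy \<longleftrightarrow> Sy \<noteq> [] \<and> (\<forall>r \<in> set Sy. top_rule r)"

definition Sys :: "hrule \<Rightarrow> srule list" where
  "Sys Hr = map (\<lambda>i. SRule (actives (Hr ! i)) (active_concl Hr i)) [0..<length Hr]"

text \<open>
  \<open>LJ_env S E s\<close>: the sequent \<open>s\<close> has a derivation in LJ extended by \<open>S\<close> in which the
  top rules in \<open>E\<close> may also be applied. An element \<open>(f, m, r)\<close> of \<open>E\<close> is a top rule
  \<open>r\<close> of an instance of a 2-system whose bottom rule is applied below; \<open>f\<close> and \<open>m\<close> are fixed by that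
  instance, so that all applications of \<open>r\<close> act on the same \<open>\<Sigma>\<^sub>0, \<dots>, \<Sigma>\<^sub>n\<close>, while the context
  assignments \<open>g\<close> and \<open>p\<close> are chosen anew for each application.
\<close>

inductive LJ_env ::
  "srule list set \<Rightarrow> ((nat \<Rightarrow> 'a form) \<times> (nat \<Rightarrow> 'a form multiset) \<times> srule) set \<Rightarrow> 'a sequent \<Rightarrow> bool"
  for S :: "srule list set"
where
  ax: "lj_axiom s \<Longrightarrow> LJ_env S E s"
| rule: "lj_rule Ps s \<Longrightarrow> \<forall>s' \<in> set Ps. LJ_env S E s' \<Longrightarrow> LJ_env S E s"
| top: "(f, m, r) \<in> E
    \<Longrightarrow> \<forall>C \<in> set (premisses r). LJ_env S E (inst f m g p C)
    \<Longrightarrow> LJ_env S E (inst f m g p (conclusion r))"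
| bot: "Sy \<in> S
    \<Longrightarrow> \<forall>i < length Sy. LJ_env S (insert (f, m, Sy ! i) E) s
    \<Longrightarrow> LJ_env S E s"

text \<open>In a complete derivation every top rule application lies above its bottom rule.\<close>

definition LJ :: "srule list set \<Rightarrow> 'a sequent \<Rightarrow> bool" where
  "LJ S s \<longleftrightarrow> LJ_env S {} s"

end

theory Submission
  imports Defs
begin

text \<open>
  A hypersequent is read as a disjunction that is forced by coverings: an environment of top rules
  forces it if repeated branching with bottom rules leads to environments each of which derives one
  of its components. An external rule application becomes one branching with the bottom rule of
  its 2-system, where branch \<open>i\<close> can use the \<open>i\<close>-th top rule to derive the \<open>i\<close>-th active component.
  For a single component the branchings form an ordinary derivation.
\<close>

inductive covered ::
  "srule list set \<Rightarrow> ((nat \<Rightarrow> 'a form) \<times> (nat \<Rightarrow> 'a form multiset) \<times> srule) set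
    \<Rightarrow> 'a hypersequent \<Rightarrow> bool"
  for S :: "srule list set"
where
  leaf: "s \<in># G \<Longrightarrow> LJ_env S E s \<Longrightarrow> covered S E G"
| branch: "Sy \<in> S \<Longrightarrow> \<forall>i < length Sy. covered S (insert (f, m, Sy ! i) E) G \<Longrightarrow> covered S E G"

lemma LJ_env_mono: "LJ_env S E s \<Longrightarrow> E \<subseteq> E' \<Longrightarrow> LJ_env S E' s"
proof (induction arbitrary: E' rule: LJ_env.induct)
  case (ax s E)
  from ax.hyps show ?case by (rule LJ_env.ax)
next
  case (rule Ps s E)
  then have "\<forall>s' \<in> set Ps. LJ_env S E' s'" by simp
  with rule.hyps(1) show ?case by (rule LJ_env.rule)
next
  case (top f m r E g p)
  then have "(f, m, r) \<in> E'" "\<forall>C \<in> set (premisses r). LJ_env S E' (inst f m g p C)" by auto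
  then show ?case by (rule LJ_env.top)
next
  case (bot Sy f m E s)
  have "\<forall>i < length Sy. LJ_env S (insert (f, m, Sy ! i) E') s"
    using bot.IH insert_mono[OF bot.prems] by simp
  with bot.hyps show ?case by (rule LJ_env.bot)
qed

text \<open>Each leaf of the branching tree for \<open>G\<close> is replaced by a covering of
  \<open>G'\<close>. Branchings only add top rules, so the environment \<open>E'\<close> at a leaf
  extends \<open>E\<close>.\<close>

lemma covered_bind:
  "covered S E G \<Longrightarrow> (\<And>E' s. E \<subseteq> E' \<Longrightarrow> s \<in># G \<Longrightarrow> LJ_env S E' s \<Longrightarrow> covered S E' G')
    \<Longrightarrow> covered S E G'"
proof (induction rule: covered.induct)
  case (leaf s G E)
  then show ?case by blast
next
  case (branch Sy f m E G)
  have "\<forall>i < length Sy. covered S (insert (f, m, Sy ! i) E) G'"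
    using branch.IH branch.prems by simp
  with branch.hyps show ?case by (rule covered.branch)
qed

text \<open>The coverings of the premisses are stacked one on another: a leaf that derives a
  component of \<open>G\<close> already covers \<open>G'\<close>, while one that derives the active
  component goes on to the next premiss. That premiss is met in an enlarged environment, hence the
  quantifier over \<open>E\<close> in the first assumption.\<close>

lemma covered_bind_list:
  assumes "\<forall>s \<in> set Ps. \<forall>E. covered S E (add_mset s G)"
    and "\<And>E'. E \<subseteq> E' \<Longrightarrow> \<forall>s \<in> set Ps. LJ_env S E' s \<Longrightarrow> covered S E' G'"
    and "G \<subseteq># G'"
  shows "covered S E G'"
  using assms
proof (induction Ps arbitrary: E)
  case Nil
  then show ?case by simp
next
  case (Cons s Ps)
  have "covered S E (add_mset s G)" using Cons.prems(1) by simp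
  then show ?case
  proof (rule covered_bind)
    fix E' t
    assume E': "E \<subseteq> E'" and t: "t \<in># add_mset s G" "LJ_env S E' t"
    show "covered S E' G'"
    proof (cases "t \<in># G")
      case True
      then show ?thesis using t Cons.prems(3) by (blast intro: covered.leaf dest: mset_subset_eqD)
    next
      case False
      then have "LJ_env S E' s" using t by simp
      \<comment> \<open>The derivation of \<open>s\<close> found at this leaf survives the later
        branchings by monotonicity.\<close>
      then have "covered S E'' G'" if "E' \<subseteq> E''" "\<forall>u \<in> set Ps. LJ_env S E'' u" for E''
        using that E' Cons.prems(2)[of E''] by (auto intro: LJ_env_mono)
      then show ?thesis using Cons.IH[of E'] Cons.prems by simp
    qed
  qed
qed

lemma covered_singleton: "covered S E {#s#} \<Longrightarrow> LJ_env S E s"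
proof (induction E "{#s#}" rule: covered.induct)
  case (leaf t E)
  then show ?case by simp
next
  case (branch Sy f m E)
  then have "\<forall>i < length Sy. LJ_env S (insert (f, m, Sy ! i) E) s" by simp
  with branch.hyps(1) show ?case by (rule LJ_env.bot)
qed

lemma HLJ_imp_covered:
  assumes "\<forall>Hr \<in> H. Sys Hr \<in> S"
  shows "HLJ H G \<Longrightarrow> covered S E G"
proof (induction arbitrary: E rule: HLJ.induct)
  case (ax s)
  then show ?case by (auto intro: covered.leaf LJ_env.ax)
next
  case (rule Ps s G)
  show ?case
  proof (rule covered_bind_list[of Ps S G])
    show "\<forall>s' \<in> set Ps. \<forall>E. covered S E (add_mset s' G)" using rule.IH by blast
    show "covered S E' (add_mset s G)" if "\<forall>s' \<in> set Ps. LJ_env S E' s'" for E'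
      using LJ_env.rule[OF rule.hyps(1) that] by (auto intro: covered.leaf)
  qed simp
next
  case (EW G s)
  from EW.IH show ?case by (rule covered_bind) (auto intro: covered.leaf)
next
  case (EC s G)
  \<comment> \<open>Leaves test membership only, so the multiplicity of \<open>s\<close> is
    irrelevant.\<close>
  from EC.IH show ?case by (rule covered_bind) (auto intro: covered.leaf)
next
  case (hyper Hr f m g p G)
  let ?c = "\<lambda>i. inst f m g p (active_concl Hr i)"
  let ?G' = "mset (map ?c [0..<length Hr]) + G"
  \<comment> \<open>The 2-system is instantiated with the \<open>f\<close> and \<open>m\<close> of
    the hypersequent rule; \<open>g\<close> and \<open>p\<close> enter only when the top rule is
    applied at a leaf.\<close>
  have branches: "covered S (insert (f, m, Sys Hr ! i) E) ?G'" if "i < length (Sys Hr)" for i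
  proof (rule covered_bind_list[of "map (inst f m g p) (actives (Hr ! i))" S G])
    have i: "i < length Hr" and r: "Sys Hr ! i = SRule (actives (Hr ! i)) (active_concl Hr i)"
      using that by (simp_all add: Sys_def)
    show "\<forall>s \<in> set (map (inst f m g p) (actives (Hr ! i))). \<forall>E. covered S E (add_mset s G)"
      using hyper.IH i by auto
    fix E'
    assume E': "insert (f, m, Sys Hr ! i) E \<subseteq> E'"
      and prems: "\<forall>s \<in> set (map (inst f m g p) (actives (Hr ! i))). LJ_env S E' s"
    have "LJ_env S E' (?c i)"
      using LJ_env.top[of f m "Sys Hr ! i" E' S g p] E' prems by (simp add: r)
    moreover have "?c i \<in># ?G'" using i by auto
    ultimately show "covered S E' ?G'" by (blast intro: covered.leaf)
  qed simp
  show ?case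
    by (rule covered.branch[of "Sys Hr" S f m]) (use assms hyper.hyps branches in simp_all)
qed

theorem theorem2:
  fixes H :: "hrule set" and S :: "srule list set"
    and \<Gamma> :: "'a form multiset" and \<Pi> :: "'a form option"
  assumes "\<forall>Sy \<in> S. two_system Sy"
    and "\<forall>Hr \<in> H. Sys Hr \<in> S"
    and "HLJ H {#\<Gamma> \<turnstile> \<Pi>#}"
  shows "LJ S (\<Gamma> \<turnstile> \<Pi>)"
  unfolding LJ_def using HLJ_imp_covered[OF assms(2,3)] by (rule covered_singleton)

end
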